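(* Let $\ell$ be a one-dimensional Lévy process with characteristic function $\phi_\ell$ and let $\Delta_n>0$ be a fixed time step. Let $F_{\Delta_n}$, the CDF of the distribution with characteristic function $(\phi_\ell)^{\Delta_n}$, be continuously differentiable on $\mathbb{R}$ with density $f_{\Delta_n}$. Assume that this distribution has finite variance and that there are constants $R>0$, $\eta>1$, $B>0$, $\theta>0$ such that $F_{\Delta_n}(-x)\le R|x|^{-\eta}$ and $1-F_{\Delta_n}(x)\le R|x|^{-\eta}$ for all $x>0$, and $|(\phi_\ell(u))^{\Delta_n}|\le B|u/(2\pi)|^{-\theta}$ for all $u\in\mathbb{R}$. Let $C,d>0$ with $d<\frac1p$ for some $p\in[1,\eta)$. Set $\psi_1:=\min(d\eta,1-d)$ and, for $m\in\mathbb{N}$, $\varepsilon_m:=m^{-q}$ with $q>\psi_1^{-1}$ and $D_m:=C\varepsilon_m^{-d}$. If $(\widetilde X_m,m\in\mathbb{N})$ is generated based on the sequence $(\varepsilon_m,m\in\mathbb{N})$ and the corresponding $D_m$, then $(\widetilde X_m,m\in\mathbb{N})$ converges to $X$ $\mathbb{P}$-almost surely.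
   Context: $\mathbb{E}[\exp(iu\ell(t))]=(\phi_\ell(u))^t$. Approximated CDF: for an even integer $M$ and $\kappa,J>0$, $\widetilde F_{\Delta_n}(x):=\sum_{k=-M/2}^{M/2}q_k\exp(i2\pi kx/J)$, where $q_0=1/2$, $q_k=\frac{1-\cos(2\pi\kappa k)}{i2\pi k}(\phi_\ell(-2\pi k/J))^{\Delta_n}$ for $0<|k|<M/2$, and $q_k=0$ for $|k|=M/2$; it is real-valued. For $D,\varepsilon>0$ the parameters $0<\kappa<2/3$, $J\ge D/\kappa$ and $M$ are chosen such that $|F_{\Delta_n}(x)-\widetilde F_{\Delta_n}(x)|<\varepsilon$ for all $x\in[-D/2,D/2]$ (under the stated bounds such a choice is always possible, by a known theorem of Hughett). $X$ is a random variable on $(\Omega,(\mathcal{A}_t,t\ge0),\mathbb{P})$ with CDF $F_{\Delta_n}$ (an increment of $\ell$ over a time step $\Delta_n$) and $U:=F_{\Delta_n}(X)\sim\mathcal{U}([0,1])$. For given $D,\varepsilon$, $\widetilde X:=\widetilde F_{\Delta_n}^{-1}(U)$, where $\widetilde F_{\Delta_n}^{-1}(u):=-D/2$ if $u<\min\widetilde F_{\Delta_n}([-D/2,D/2])$; $\widetilde F_{\Delta_n}^{-1}(u):=D/2$ if $u>\max\widetilde F_{\Delta_n}([-D/2,D/2])$; and $\widetilde F_{\Delta_n}^{-1}(u):=\inf\{x\in[-D/2,D/2]:\widetilde F_{\Delta_n}(x)=u\}$ otherwise. $\widetilde X_m$ denotes $\widetilde X$ for $\varepsilon=\varepsilon_m$,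 $D=D_m$ (same $X$ and $U$ for all $m$). *)

theory Defs
  imports "HOL-Probability.Probability"
begin

text \<open>Time runs through the nonnegative reals; the values of \<open>A\<close> and \<open>l\<close> at negative
  times are unconstrained and never used.\<close>

locale filtered_prob_space = prob_space P for P :: "'a measure" +
  fixes A :: "real \<Rightarrow> 'a measure"
  assumes subalgebra_A: "\<And>t. 0 \<le> t \<Longrightarrow> subalgebra P (A t)"
    and A_mono: "\<And>s t. 0 \<le> s \<Longrightarrow> s \<le> t \<Longrightarrow> sets (A s) \<subseteq> sets (A t)"

text \<open>A real-valued Levy process in law: no path regularity beyond stochastic continuity is
  required.\<close>

locale levy_process = filtered_prob_space P A for P :: "'a measure" and A +
  fixes l :: "real \<Rightarrow> 'a \<Rightarrow> real"
  assumes adapted: "\<And>t. 0 \<le> t \<Longrightarrow> l t \<in> borel_measurable (A t)"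
    and zero_start: "AE \<omega> in P. l 0 \<omega> = 0"
    and indep_increments:
      "\<And>(n::nat) (t::nat \<Rightarrow> real). 0 \<le> t 0 \<Longrightarrow> strict_mono t \<Longrightarrow>
         indep_vars (\<lambda>_. borel) (\<lambda>i \<omega>. l (t (Suc i)) \<omega> - l (t i) \<omega>) {..<n}"
    and stationary_increments:
      "\<And>s h. 0 \<le> s \<Longrightarrow> 0 \<le> h \<Longrightarrow>
         distr P borel (\<lambda>\<omega>. l (s + h) \<omega> - l s \<omega>) = distr P borel (\<lambda>\<omega>. l h \<omega> - l 0 \<omega>)"
    and stochastically_continuous:
      "\<And>t e. 0 \<le> t \<Longrightarrow> 0 < e \<Longrightarrow>
         ((\<lambda>s. prob {\<omega> \<in> space P. \<bar>l s \<omega> - l t \<omega>\<bar> > e}) \<longlongrightarrow> 0) (at t within {0..})"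

definition levy_char :: "'a measure \<Rightarrow> (real \<Rightarrow> 'a \<Rightarrow> real) \<Rightarrow> real \<Rightarrow> complex" where
  "levy_char P l = char (distr P borel (l 1))"

text \<open>For a Levy process the identity \<open>E[exp(i u l(t))] = (levy_char P l u)^t\<close> holds with the power
  taken via the continuous logarithm vanishing at 0. The principal branch, used by \<open>powr\<close>, would
  give wrong values as soon as the argument of the characteristic function leaves
  \<open>(-pi, pi]\<close>.\<close>

definition char_log :: "(real \<Rightarrow> complex) \<Rightarrow> real \<Rightarrow> complex" where
  "char_log \<phi> = (THE \<psi>. continuous_on UNIV \<psi> \<and> \<psi> 0 = 0 \<and> (\<forall>u. exp (\<psi> u) = \<phi> u))"

definition char_pow :: "(real \<Rightarrow> complex) \<Rightarrow> real \<Rightarrow> real \<Rightarrow> complex" where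
  "char_pow \<phi> t u = exp (of_real t * char_log \<phi> u)"

lemma continuous_log_unique:
  fixes \<psi> \<psi>' :: "real \<Rightarrow> complex"
  assumes "continuous_on UNIV \<psi>" "continuous_on UNIV \<psi>'" "\<psi> 0 = \<psi>' 0"
    and eq: "\<And>u. exp (\<psi> u) = exp (\<psi>' u)"
  shows "\<psi> = \<psi>'"
proof -
  let ?g = "\<lambda>u. \<psi> u - \<psi>' u"
  have g1: "exp (?g u) = 1" for u by (simp add: exp_diff eq)
  have "?g constant_on UNIV"
  proof (rule continuous_discrete_range_constant)
    show "connected (UNIV :: real set)" by simp
    show "continuous_on UNIV ?g" using assms by (intro continuous_intros)
    fix x :: real
    show "\<exists>e>0. \<forall>y. y \<in> UNIV \<and> ?g y \<noteq> ?g x \<longrightarrow> e \<le> norm (?g y - ?g x)"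
    proof (intro exI[of _ "2 * pi"] conjI allI impI)
      show "0 < 2 * pi" by simp
      fix y assume y: "y \<in> UNIV \<and> ?g y \<noteq> ?g x"
      have "exp (?g y) = exp (?g x)" by (simp only: g1)
      then obtain n :: int where n: "?g y = ?g x + (of_int (2 * n) * pi) * \<i>"
        using exp_eq[of "?g y" "?g x"] by auto
      hence *: "?g y - ?g x = (of_int (2 * n) * pi) * \<i>" by (simp only: n) simp
      have "n \<noteq> 0" using n y by auto
      hence "1 \<le> \<bar>real_of_int n\<bar>" by linarith
      moreover have "norm (?g y - ?g x) = 2 * pi * \<bar>real_of_int n\<bar>"
        unfolding * by (simp add: norm_mult)
      ultimately show "2 * pi \<le> norm (?g y - ?g x)" by simp
    qed
  qed
  then obtain c where c: "\<And>u. ?g u = c" by (auto simp: constant_on_def)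
  have "c = 0" using c[of 0] assms(3) by simp
  with c show ?thesis by (intro ext) simp
qed

lemma char_log_props:
  assumes "continuous_on UNIV \<phi>" "\<phi> 0 = 1" "\<And>u. \<phi> u \<noteq> 0"
  shows "continuous_on UNIV (char_log \<phi>)" "char_log \<phi> 0 = 0" "\<And>u. exp (char_log \<phi> u) = \<phi> u"
proof -
  let ?Q = "\<lambda>\<psi>. continuous_on UNIV \<psi> \<and> \<psi> 0 = 0 \<and> (\<forall>u. exp (\<psi> u) = \<phi> u)"
  obtain g where g: "continuous_on UNIV g" "\<And>u. \<phi> u = exp (g u)"
    using continuous_logarithm_on_contractible[of "UNIV :: real set" \<phi>] assms
      convex_imp_contractible[of "UNIV :: real set"] by auto
  have "exp (g 0) = 1" using g(2)[of 0] assms(2) by simp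
  hence "?Q (\<lambda>u. g u - g 0)"
    using g by (auto intro!: continuous_intros simp: exp_diff)
  moreover have "\<psi> = \<psi>'" if "?Q \<psi>" "?Q \<psi>'" for \<psi> \<psi>'
    using that by (intro continuous_log_unique) auto
  ultimately have "\<exists>!\<psi>. ?Q \<psi>" by blast
  from theI'[OF this] have "?Q (char_log \<phi>)" unfolding char_log_def .
  thus "continuous_on UNIV (char_log \<phi>)" "char_log \<phi> 0 = 0" "\<And>u. exp (char_log \<phi> u) = \<phi> u"
    by auto
qed

text \<open>In the following, \<open>g\<close> is the characteristic function of the increment to be simulated.\<close>

definition fourier_coeff :: "(real \<Rightarrow> complex) \<Rightarrow> real \<Rightarrow> real \<Rightarrow> int \<Rightarrow> int \<Rightarrow> complex" where
  "fourier_coeff g \<kappa> J M k =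
     (if k = 0 then 1 / 2
      else if \<bar>k\<bar> < M div 2
        then of_real (1 - cos (2 * pi * \<kappa> * of_int k)) / (\<i> * of_real (2 * pi * of_int k))
               * g (- 2 * pi * of_int k / J)
      else 0)"

definition cdf_approx_sum :: "(real \<Rightarrow> complex) \<Rightarrow> real \<Rightarrow> real \<Rightarrow> int \<Rightarrow> real \<Rightarrow> complex" where
  "cdf_approx_sum g \<kappa> J M x =
     (\<Sum>k\<in>{- (M div 2)..M div 2}.
        fourier_coeff g \<kappa> J M k * exp (\<i> * of_real (2 * pi * of_int k * x / J)))"

text \<open>The sum is real for every characteristic function \<open>g\<close> (shown below), so taking the real
  part is only a change of type.\<close>

definition cdf_approx :: "(real \<Rightarrow> complex) \<Rightarrow> real \<Rightarrow> real \<Rightarrow> int \<Rightarrow> real \<Rightarrow> real" where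
  "cdf_approx g \<kappa> J M x = Re (cdf_approx_sum g \<kappa> J M x)"

lemma of_real_cdf_approx:
  assumes "\<And>u. g (- u) = cnj (g u)"
  shows "complex_of_real (cdf_approx g \<kappa> J M x) = cdf_approx_sum g \<kappa> J M x"
proof -
  let ?a = "\<lambda>k::int. fourier_coeff g \<kappa> J M k * exp (\<i> * of_real (2 * pi * of_int k * x / J))"
  have q: "cnj (fourier_coeff g \<kappa> J M k) = fourier_coeff g \<kappa> J M (- k)" for k
    using assms[of "2 * pi * of_int k / J"] by (simp add: fourier_coeff_def)
  have "cnj (?a k) = ?a (- k)" for k
    by (simp add: q exp_cnj)
  hence "cnj (cdf_approx_sum g \<kappa> J M x) = (\<Sum>k\<in>{- (M div 2)..M div 2}. ?a (- k))"
    by (simp add: cdf_approx_sum_def)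
  also have "\<dots> = cdf_approx_sum g \<kappa> J M x"
    unfolding cdf_approx_sum_def
    by (rule sum.reindex_bij_witness[of _ uminus uminus]) auto
  finally have "cdf_approx_sum g \<kappa> J M x \<in> \<real>" by (simp add: Reals_cnj_iff)
  thus ?thesis by (simp add: cdf_approx_def)
qed

lemma char_uminus: "char \<mu> (- u) = cnj (char \<mu> u)"
proof -
  have "cnj (char \<mu> u) = (CLINT x|\<mu>. cnj (iexp (u * x)))"
    unfolding char_def by (rule Bochner_Integration.integral_cnj[symmetric])
  also have "\<dots> = char \<mu> (- u)"
    unfolding char_def by (simp add: exp_cnj)
  finally show ?thesis by simp
qed

text \<open>\<open>Inf\<close> and \<open>Sup\<close> of the image are its minimum and maximum, and the last infimum is over a
  nonempty set, whenever \<open>G\<close> is continuous and \<open>D\<close> is nonnegative.\<close>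

definition truncated_inverse :: "(real \<Rightarrow> real) \<Rightarrow> real \<Rightarrow> real \<Rightarrow> real" where
  "truncated_inverse G D u =
     (if u < Inf (G ` {- D / 2..D / 2}) then - D / 2
      else if u > Sup (G ` {- D / 2..D / 2}) then D / 2
      else Inf {x \<in> {- D / 2..D / 2}. G x = u})"

end

(* The limit X is recovered path by path. Almost surely X is not in a flat piece of F, since each
   of the countably many levels on which F is constant carries no mass. At such a value x we have
   F (x - h) < F x < F (x + h), and as soon as the uniform error is below both gaps and the window
   contains [x - h, x + h], the smallest solution of G y = F x must lie in that interval, where G is
   the approximate CDF. *)
theory Submission
  imports Defs "HOL-Real_Asymp.Real_Asymp"
begin

lemma continuous_on_cdf_approx: "continuous_on S (cdf_approx g \<kappa> J M)"
  \<comment> \<open>Turning \<open>x / J\<close> into multiplication by the constant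
    \<open>inverse J\<close> avoids a side condition \<open>J \<noteq> 0\<close>.\<close>
  unfolding cdf_approx_def cdf_approx_sum_def divide_inverse
  by (intro continuous_intros)

text \<open>\<open>G\<close> need not be monotone, and the inverse selects the smallest solution.
  Hence \<open>below\<close> must exclude solutions on all of \<open>{- D / 2..a}\<close>, while one
  value above \<open>u\<close> at \<open>b\<close> is enough to produce a solution by the
  intermediate value theorem.\<close>

lemma truncated_inverse_between:
  assumes cont: "continuous_on {- D / 2..D / 2} G"
    and ab: "- D / 2 \<le> a" "a \<le> b" "b \<le> D / 2"
    and below: "\<And>y. y \<in> {- D / 2..a} \<Longrightarrow> G y < u"
    and above: "u < G b"
  shows "truncated_inverse G D u \<in> {a..b}"
proof -
  let ?I = "{- D / 2..D / 2}"
  have "compact (G ` ?I)"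
    using cont by (intro compact_continuous_image) auto
  hence bdd: "bdd_below (G ` ?I)" "bdd_above (G ` ?I)"
    by (auto intro: bounded_imp_bdd_below bounded_imp_bdd_above compact_imp_bounded)
  \<comment> \<open>The values at \<open>a\<close> and \<open>b\<close> lie on either side of
    \<open>u\<close>, which rules out both clipped branches of the definition.\<close>
  have "Inf (G ` ?I) \<le> G a"
    using ab bdd by (intro cInf_lower) auto
  also have "G a < u" using ab by (intro below) auto
  finally have 1: "\<not> u < Inf (G ` ?I)" by simp
  have "G b \<le> Sup (G ` ?I)"
    using ab bdd by (intro cSup_upper) auto
  with above have 2: "\<not> u > Sup (G ` ?I)" by simp
  have "continuous_on {a..b} G"
    using ab by (intro continuous_on_subset[OF cont]) auto
  then obtain z where z: "a \<le> z" "z \<le> b" "G z = u"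
    using IVT'[of G a u b] \<open>G a < u\<close> above ab by auto
  let ?S = "{x \<in> ?I. G x = u}"
  have zS: "z \<in> ?S" using z ab by auto
  have lower: "a \<le> y" if "y \<in> ?S" for y
    using below[of y] that by force
  have "a \<le> Inf ?S" using zS lower by (intro cInf_greatest) auto
  moreover have "Inf ?S \<le> z" using zS lower by (intro cInf_lower bdd_belowI[of _ a]) auto
  ultimately show ?thesis using 1 2 z by (simp add: truncated_inverse_def)
qed

lemma truncated_inverse_tendsto:
  fixes F :: "real \<Rightarrow> real" and G :: "nat \<Rightarrow> real \<Rightarrow> real"
  assumes mono: "mono F"
    and inj: "\<And>y. y \<noteq> x \<Longrightarrow> F y \<noteq> F x"
    and cont: "\<And>m. continuous_on {- D m / 2..D m / 2} (G m)"
    and D: "filterlim D at_top sequentially"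
    and e: "e \<longlonglongrightarrow> 0"
    and approx: "\<forall>\<^sub>F m in sequentially. \<forall>y\<in>{- D m / 2..D m / 2}. \<bar>F y - G m y\<bar> < e m"
  shows "(\<lambda>m. truncated_inverse (G m) (D m) (F x)) \<longlonglongrightarrow> x"
proof (rule tendstoI)
  fix r :: real assume "r > 0"
  \<comment> \<open>Half the radius puts the closed interval \<open>{x - h..x + h}\<close> inside
    the open ball of radius \<open>r\<close>.\<close>
  define h where "h = r / 2"
  have h: "h > 0" "h < r" using \<open>r > 0\<close> by (auto simp: h_def)
  have gaps: "F x - F (x - h) > 0" "F (x + h) - F x > 0"
    using monoD[OF mono, of "x - h" x] monoD[OF mono, of x "x + h"]
      inj[of "x - h"] inj[of "x + h"] h by auto
  have "\<forall>\<^sub>F m in sequentially. D m > 2 * (\<bar>x\<bar> + h)"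
    using D by (simp add: filterlim_at_top_dense)
  moreover have "\<forall>\<^sub>F m in sequentially. e m < F x - F (x - h)"
    "\<forall>\<^sub>F m in sequentially. e m < F (x + h) - F x"
    using gaps by (auto intro: order_tendstoD(2)[OF e])
  ultimately show "\<forall>\<^sub>F m in sequentially. dist (truncated_inverse (G m) (D m) (F x)) x < r"
    using approx
  proof eventually_elim
    case (elim m)
    have "truncated_inverse (G m) (D m) (F x) \<in> {x - h..x + h}"
    proof (rule truncated_inverse_between[OF cont])
      show "- D m / 2 \<le> x - h" "x - h \<le> x + h" "x + h \<le> D m / 2"
        using elim(1) h by auto
      fix y assume y: "y \<in> {- D m / 2..x - h}"
      hence "\<bar>F y - G m y\<bar> < e m" using elim(1,4) h by auto
      \<comment> \<open>Monotonicity of \<open>F\<close> carries the gap at \<open>x - h\<close> to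
        every point further left, so oscillations of \<open>G m\<close> there cannot reach the level
        \<open>F x\<close>.\<close>
      moreover have "F y \<le> F (x - h)" using y by (intro monoD[OF mono]) auto
      ultimately show "G m y < F x" using elim(2) by linarith
    next
      have "x + h \<in> {- D m / 2..D m / 2}" using elim(1) h by auto
      hence "\<bar>F (x + h) - G m (x + h)\<bar> < e m" using elim(4) by blast
      thus "F x < G m (x + h)" using elim(3) by linarith
    qed
    thus ?case using h by (auto simp: dist_real_def)
  qed
qed

context real_distribution
begin

text \<open>By monotonicity a level set is an interval. Its half-open part \<open>{a<..b}\<close>
  has mass \<open>cdf M b - cdf M a = 0\<close>, and continuity excludes an atom at the remaining
  endpoint \<open>a\<close>.\<close>

lemma AE_cdf_neq:
  assumes cont: "continuous_on UNIV (cdf M)"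
  shows "AE x in M. cdf M x \<noteq> c"
proof -
  \<comment> \<open>The levels 0 and 1 can be attained on unbounded sets. Cutting with
    \<open>{- real n..real n}\<close> makes the level set compact, so that its endpoints
    \<open>a\<close> and \<open>b\<close> exist when it is nonempty; the countably many cuts cover
    the line.\<close>
  have null: "AE x in M. \<not> (x \<in> {- real n..real n} \<and> cdf M x = c)" for n
  proof -
    let ?S = "{- real n..real n} \<inter> cdf M -` {c}"
    have "closed (cdf M -` {c})"
      using cont by (intro closed_vimage) auto
    hence cpt: "compact ?S" by (intro compact_Int_closed) auto
    show ?thesis
    proof (cases "?S = {}")
      case False
      obtain a where a: "a \<in> ?S" "\<And>y. y \<in> ?S \<Longrightarrow> a \<le> y"
        using compact_attains_inf[OF cpt False] by auto
      obtain b where b: "b \<in> ?S" "\<And>y. y \<in> ?S \<Longrightarrow> y \<le> b"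
        using compact_attains_sup[OF cpt False] by auto
      have ab: "a \<le> b" "cdf M a = cdf M b" using a b by auto
      have "measure M {a<..b} = 0"
        \<comment> \<open>\<open>cdf_diff_eq\<close> needs \<open>a < b\<close>; for
          \<open>a = b\<close> the interval is empty.\<close>
        using cdf_diff_eq[of a b] ab by (cases "a = b") auto
      moreover have "measure M {a} = 0"
        using cont by (simp flip: isCont_cdf add: continuous_on_eq_continuous_at)
      ultimately have "{a<..b} \<in> null_sets M" "{a} \<in> null_sets M"
        by (auto simp: null_sets_def emeasure_eq_measure)
      hence "{a} \<union> {a<..b} \<in> null_sets M" by blast
      moreover have "?S \<subseteq> {a} \<union> {a<..b}" using a b by force
      ultimately show ?thesis by (intro AE_I'[of "{a} \<union> {a<..b}"]) auto
    qed (auto intro!: AE_I2)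
  qed
  have "AE x in M. \<forall>n. \<not> (x \<in> {- real n..real n} \<and> cdf M x = c)"
    using null by (simp add: AE_all_countable)
  thus ?thesis
  proof eventually_elim
    case (elim x)
    obtain n :: nat where "\<bar>x\<bar> \<le> real n" using real_arch_simple by blast
    thus ?case using elim by (auto simp: abs_le_iff)
  qed
qed

text \<open>If the value at \<open>x\<close> recurs at some \<open>y \<noteq> x\<close>,
  monotonicity makes it recur at a rational between them. So only the levels
  \<open>cdf M (of_rat r)\<close> have to be avoided, and these are countably many.\<close>

lemma AE_cdf_strict:
  assumes cont: "continuous_on UNIV (cdf M)"
  shows "AE x in M. \<forall>y. y \<noteq> x \<longrightarrow> cdf M y \<noteq> cdf M x"
proof -
  have "AE x in M. \<forall>r::rat. cdf M x \<noteq> cdf M (of_rat r)"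
    using AE_cdf_neq[OF cont] by (simp add: AE_all_countable)
  thus ?thesis
  proof eventually_elim
    case (elim x)
    show ?case
    proof (intro allI impI notI)
      fix y assume y: "y \<noteq> x" "cdf M y = cdf M x"
      hence "min x y < max x y" by auto
      then obtain r where r: "min x y < of_rat r" "of_rat r < max x y"
        using of_rat_dense by blast
      have "cdf M (min x y) \<le> cdf M (of_rat r)" "cdf M (of_rat r) \<le> cdf M (max x y)"
        using r by (auto intro: cdf_nondecreasing)
      with y have "cdf M x = cdf M (of_rat r)" by (auto simp: min_def max_def split: if_splits)
      with elim show False by blast
    qed
  qed
qed

end

theorem corollary3p19:
  fixes P :: "'a measure" and A :: "real \<Rightarrow> 'a measure" and l :: "real \<Rightarrow> 'a \<Rightarrow> real"
    and \<Delta> :: real and \<mu> :: "real measure" and F f :: "real \<Rightarrow> real"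
    and R \<eta> B \<theta> C d p q \<psi>\<^sub>1 :: real
    and \<epsilon> D \<kappa> J :: "nat \<Rightarrow> real" and M :: "nat \<Rightarrow> int"
    and X U :: "'a \<Rightarrow> real" and Xt :: "nat \<Rightarrow> 'a \<Rightarrow> real"
  assumes levy: "levy_process P A l"
    and \<Delta>_pos: "\<Delta> > 0"
    and \<mu>: "real_distribution \<mu>" "\<And>u. char \<mu> u = char_pow (levy_char P l) \<Delta> u"
    and F: "F = cdf \<mu>"
    and F_C1: "\<And>x. (F has_real_derivative f x) (at x)" "continuous_on UNIV f"
    and finite_variance: "integrable \<mu> (\<lambda>x. x)"
      "integrable \<mu> (\<lambda>x. (x - prob_space.expectation \<mu> (\<lambda>y. y))\<^sup>2)"
    and constants_pos: "R > 0" "\<eta> > 1" "B > 0" "\<theta> > 0"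
    and lower_tail: "\<And>x. x > 0 \<Longrightarrow> F (- x) \<le> R * \<bar>x\<bar> powr (- \<eta>)"
    and upper_tail: "\<And>x. x > 0 \<Longrightarrow> 1 - F x \<le> R * \<bar>x\<bar> powr (- \<eta>)"
    and char_decay: "\<And>u. u \<noteq> 0 \<Longrightarrow>
      cmod (char_pow (levy_char P l) \<Delta> u) \<le> B * \<bar>u / (2 * pi)\<bar> powr (- \<theta>)"
    and C_pos: "C > 0" and d_pos: "d > 0"
    and p: "1 \<le> p" "p < \<eta>" "d < 1 / p"
    and \<psi>\<^sub>1: "\<psi>\<^sub>1 = min (d * \<eta>) (1 - d)"
    and q: "q > inverse \<psi>\<^sub>1"
    and \<epsilon>: "\<And>m. m \<ge> 1 \<Longrightarrow> \<epsilon> m = real m powr (- q)"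
    and D: "\<And>m. m \<ge> 1 \<Longrightarrow> D m = C * \<epsilon> m powr (- d)"
    and \<kappa>: "\<And>m. m \<ge> 1 \<Longrightarrow> 0 < \<kappa> m \<and> \<kappa> m < 2 / 3"
    and J: "\<And>m. m \<ge> 1 \<Longrightarrow> J m \<ge> D m / \<kappa> m"
    and M: "\<And>m. m \<ge> 1 \<Longrightarrow> even (M m) \<and> M m > 0"
    and approx: "\<And>m x. m \<ge> 1 \<Longrightarrow> x \<in> {- D m / 2..D m / 2} \<Longrightarrow>
      \<bar>F x - cdf_approx (char_pow (levy_char P l) \<Delta>) (\<kappa> m) (J m) (M m) x\<bar> < \<epsilon> m"
    and X: "X \<in> borel_measurable P" "cdf (distr P borel X) = F"
    and U: "\<And>\<omega>. U \<omega> = F (X \<omega>)"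
    and Xt: "\<And>m \<omega>. m \<ge> 1 \<Longrightarrow> Xt m \<omega> =
      truncated_inverse (cdf_approx (char_pow (levy_char P l) \<Delta>) (\<kappa> m) (J m) (M m)) (D m) (U \<omega>)"
  shows "AE \<omega> in P. (\<lambda>m. Xt m \<omega>) \<longlonglongrightarrow> X \<omega>"
proof -
  interpret levy_process P A l by (rule levy)
  interpret law: real_distribution "distr P borel X"
    using X(1) by (intro real_distribution_distr)
  have contF: "continuous_on UNIV F"
    using F_C1(1) by (auto intro!: continuous_at_imp_continuous_on DERIV_isCont)
  have monoF: "mono F"
    using law.cdf_nondecreasing X(2) by (auto intro: monoI)
  \<comment> \<open>From \<open>p \<ge> 1\<close> follows \<open>1 / p \<le> 1\<close>. Thus both
    entries of the minimum defining \<open>\<psi>\<^sub>1\<close> are positive, and the bound on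
    \<open>q\<close> forces \<open>q > 0\<close>.\<close>
  have "d < 1"
    using p(3) by (rule order.strict_trans2) (use p(1) in simp)
  hence "\<psi>\<^sub>1 > 0" using \<psi>\<^sub>1 constants_pos d_pos by auto
  hence "inverse \<psi>\<^sub>1 > 0" by simp
  hence "q > 0" using q by linarith
  have "(\<lambda>m. real m powr (- q)) \<longlonglongrightarrow> 0"
    using \<open>q > 0\<close> by real_asymp
  hence \<epsilon>0: "\<epsilon> \<longlonglongrightarrow> 0"
    by (rule Lim_transform_eventually) (auto simp: \<epsilon> intro!: eventually_sequentiallyI[of 1])
  \<comment> \<open>For \<open>m \<ge> 1\<close> this is \<open>D m\<close>: the exponents
    \<open>- q\<close> and \<open>- d\<close> multiply to \<open>q * d > 0\<close>.\<close>
  have "filterlim (\<lambda>m. C * real m powr (q * d)) at_top sequentially"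
    using C_pos mult_pos_pos[OF \<open>q > 0\<close> d_pos] by real_asymp
  hence D_top: "filterlim D at_top sequentially"
    by (rule filterlim_mono_eventually)
       (auto simp: D \<epsilon> powr_powr intro!: eventually_sequentiallyI[of 1])
  have "AE x in distr P borel X. \<forall>y. y \<noteq> x \<longrightarrow> F y \<noteq> F x"
    using law.AE_cdf_strict contF X(2) by simp
  \<comment> \<open>The exceptional set is pulled back along \<open>X\<close>; from here on
    \<open>\<omega>\<close> is fixed and the argument is deterministic.\<close>
  hence "AE \<omega> in P. \<forall>y. y \<noteq> X \<omega> \<longrightarrow> F y \<noteq> F (X \<omega>)"
    using X(1) by (rule AE_distrD[rotated])
  thus ?thesis
  proof eventually_elim
    case (elim \<omega>)
    let ?G = "\<lambda>m. cdf_approx (char_pow (levy_char P l) \<Delta>) (\<kappa> m) (J m) (M m)"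
    have "(\<lambda>m. truncated_inverse (?G m) (D m) (F (X \<omega>))) \<longlonglongrightarrow> X \<omega>"
      using elim approx
      by (intro truncated_inverse_tendsto[OF monoF _ continuous_on_cdf_approx D_top \<epsilon>0])
         (auto intro!: eventually_sequentiallyI[of 1])
    thus ?case
      by (rule Lim_transform_eventually) (auto simp: Xt U intro!: eventually_sequentiallyI[of 1])
  qed
qed

end
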